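(* Let $t\ge2$, $r\ge1$, $N=t+2r$, and let $N_\delta=\det(x_i^{\delta_j})_{i,j=1}^N$ with $\delta=(N-1,N-2,\dots,0)$ and $x=(1,\zeta,\dots,\zeta^{t-1},z_1,z_1^{-1},\dots,z_r,z_r^{-1})$, $\zeta=e^{2\pi i/t}$, a Laurent polynomial in $z_1,\dots,z_r$. Then, as a polytope in $\mathbb R^r$: (i) $\mathrm{Newt}(N_\delta)$ is the zonotope $$\bigoplus_{k=1}^r\bigl[-(t+1)e_k,(t+1)e_k\bigr]\ \oplus\ \bigoplus_{k<l}\Bigl(\bigl[-(e_k-e_l),e_k-e_l\bigr]\oplus\bigl[-(e_k+e_l),e_k+e_l\bigr]\Bigr).$$ (ii) Equivalently, it is the orbit polytope $\mathrm{conv}\bigl(W(C_r)\cdot(N-1,N-3,\dots,N-2r+1)\bigr)$, and it has exactly $2^r r!$ vertices, one for each element of $W(C_r)$. (iii) In particular the dominant vertex of $\mathrm{Newt}(N_\delta)$ is $(N-1,N-3,\dots,N-2r+1)$.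
   Context: $\mathrm{Newt}(f)$ is the Newton polytope of a Laurent polynomial $f$ in $z_1,\dots,z_r$: the convex hull of the exponent vectors with nonzero coefficient. $\oplus$ is Minkowski sum, $e_k$ the standard basis of $\mathbb R^r$, $[a,b]$ the segment from $a$ to $b$. $W(C_r)$ is the group of signed permutations of the coordinates. The dominant vertex is the vertex in the chamber $x_1\ge x_2\ge\dots\ge x_r\ge0$. *)

theory Defs
  imports
    "HOL-Analysis.Analysis"
    "HOL-Library.Poly_Mapping"
    "Jordan_Normal_Form.Determinant"
begin

no_notation Matrix.vec_index (infixl \<open>$\<close> 100)

text \<open>
  Laurent polynomials over the complex numbers in variables indexed by a finite type are elements of
  the monoid algebra of the exponent lattice. The coordinates are numbered by a bijection
  \<open>ix\<close> from \<open>{1..r}\<close> to the index type, so that the \<open>k\<close>-th coordinate of \<open>p\<close> is \<open>p $ ix k\<close>.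
\<close>

type_synonym 'r laurent = "(int ^ 'r) \<Rightarrow>\<^sub>0 complex"

definition laurent_const :: "complex \<Rightarrow> 'r::finite laurent" where
  "laurent_const c = Poly_Mapping.single 0 c"

definition laurent_var :: "'r::finite \<Rightarrow> 'r laurent" where
  "laurent_var i = Poly_Mapping.single (axis i 1) 1"

definition laurent_var_inv :: "'r::finite \<Rightarrow> 'r laurent" where
  "laurent_var_inv i = Poly_Mapping.single (axis i (-1)) 1"

definition Newt :: "'r::finite laurent \<Rightarrow> (real ^ 'r) set" where
  "Newt f = convex hull ((\<lambda>\<alpha>. \<chi> i. real_of_int (\<alpha> $ i)) ` Poly_Mapping.keys f)"

definition zeta :: "nat \<Rightarrow> complex" where
  "zeta t = exp (2 * of_real pi * \<i> / of_nat t)"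

definition spec_vars :: "nat \<Rightarrow> nat \<Rightarrow> (nat \<Rightarrow> 'r::finite) \<Rightarrow> 'r laurent list" where
  "spec_vars t r ix =
     map (\<lambda>a. laurent_const (zeta t ^ a)) [0..<t] @
     concat (map (\<lambda>k. [laurent_var (ix k), laurent_var_inv (ix k)]) [1..<r + 1])"

text \<open>Rows and columns are numbered from \<open>0\<close>, so the entry of \<open>\<delta>\<close> in column \<open>j\<close> is \<open>N - 1 - j\<close>.\<close>

definition N_delta :: "nat \<Rightarrow> nat \<Rightarrow> (nat \<Rightarrow> 'r::finite) \<Rightarrow> 'r laurent" where
  "N_delta t r ix =
     (let N = t + 2 * r
      in Determinant.det (Matrix.mat N N (\<lambda>(i, j). (spec_vars t r ix ! i) ^ (N - 1 - j))))"

definition std_basis :: "(nat \<Rightarrow> 'r::finite) \<Rightarrow> nat \<Rightarrow> real ^ 'r" where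
  "std_basis ix k = axis (ix k) 1"

definition signed_perms :: "(real ^ 'r \<Rightarrow> real ^ 'r::finite) set" where
  "signed_perms = {w. \<exists>\<pi> s. \<pi> permutes UNIV \<and> (\<forall>i. s i \<in> {-1, 1}) \<and> w = (\<lambda>x. \<chi> i. s i * x $ \<pi> i)}"

definition dominant_chamber :: "nat \<Rightarrow> (nat \<Rightarrow> 'r::finite) \<Rightarrow> (real ^ 'r) set" where
  "dominant_chamber r ix =
     {x. (\<forall>k l. 1 \<le> k \<and> k < l \<and> l \<le> r \<longrightarrow> x $ ix k \<ge> x $ ix l) \<and> x $ ix r \<ge> 0}"

text \<open>The sums below, and the addition of segments, are Minkowski sums (\<open>HOL-Library.Set_Algebras\<close>).\<close>

definition zonotope_C :: "nat \<Rightarrow> nat \<Rightarrow> (nat \<Rightarrow> 'r::finite) \<Rightarrow> (real ^ 'r) set" where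
  "zonotope_C t r ix =
     (let e = std_basis ix
      in (\<Sum>k\<in>{1..r}. closed_segment (- (real (t + 1) *\<^sub>R e k)) (real (t + 1) *\<^sub>R e k)) +
         (\<Sum>(k, l)\<in>{(k, l). 1 \<le> k \<and> k < l \<and> l \<le> r}.
            closed_segment (- (e k - e l)) (e k - e l) + closed_segment (- (e k + e l)) (e k + e l)))"

text \<open>The vector \<open>(N - 1, N - 3, \<dots>, N - 2 r + 1)\<close>.\<close>

definition top_vector :: "nat \<Rightarrow> nat \<Rightarrow> (nat \<Rightarrow> 'r::finite) \<Rightarrow> real ^ 'r" where
  "top_vector N r ix = (\<Sum>k\<in>{1..r}. (real N - 2 * real k + 1) *\<^sub>R std_basis ix k)"

end

theory Submission
  imports Defs
begin

text \<open>
  By the Vandermonde identity, \<open>N_delta\<close> is the product of the differences of its variables. Newton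
  polytopes turn products into Minkowski sums, the factors that are differences of two roots of
  unity contribute a point, and the remaining segments are paired with their negatives, which gives
  the zonotope. A vertex of the zonotope is the unique maximum of a linear functional \<open>c\<close>;
  it exists iff \<open>c\<close> vanishes on none of the generators, that is iff the \<open>\<bar>c\<^sub>i\<bar>\<close> are nonzero and
  distinct, and it then has coordinates \<open>sgn c\<^sub>i (t + 1 + 2 n\<^sub>i)\<close>, where \<open>n\<^sub>i\<close> counts the \<open>j\<close> with
  \<open>\<bar>c\<^sub>j\<bar> < \<bar>c\<^sub>i\<bar>\<close>. These are exactly the signed permutations of the top vector.
\<close>

section \<open>The Vandermonde determinant with exponents decreasing along a row\<close>

lemma det_scale_rows:
  fixes c :: "nat \<Rightarrow> 'a::comm_ring_1"
  shows "Determinant.det (Matrix.mat n n (\<lambda>(i, j). c i * f i j)) =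
    (\<Prod>i<n. c i) * Determinant.det (Matrix.mat n n (\<lambda>(i, j). f i j))"
  by (auto simp: Determinant.det_def sum_distrib_left prod.distrib lessThan_atLeast0 mult.left_commute
      intro!: sum.cong)

text \<open>Right multiplication by the unitriangular \<open>B\<close> subtracts \<open>x 0\<close>
  times the next column from each column but the last. Row 0 then vanishes except for its last
  entry, and expanding along it leaves a row-scaled Vandermonde matrix in the other \<open>n\<close>
  variables.\<close>

lemma det_vandermonde:
  fixes x :: "nat \<Rightarrow> 'a::comm_ring_1"
  shows "Determinant.det (Matrix.mat n n (\<lambda>(i, j). x i ^ (n - 1 - j))) = (\<Prod>j<n. \<Prod>i<j. x i - x j)"
proof (induction n arbitrary: x)
  case 0
  then show ?case by simp
next
  case (Suc n)
  define A where "A = Matrix.mat (Suc n) (Suc n) (\<lambda>(i, j). x i ^ (n - j))"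
  define B where "B = Matrix.mat (Suc n) (Suc n)
    (\<lambda>(k, j). if k = j then 1 else if k = Suc j then - x 0 else 0)"
  define C where "C = Matrix.mat (Suc n) (Suc n)
    (\<lambda>(i, j). if j = n then 1 else (x i - x 0) * x i ^ (n - 1 - j))"
  have A: "A \<in> carrier_mat (Suc n) (Suc n)" and B: "B \<in> carrier_mat (Suc n) (Suc n)"
    and C: "C \<in> carrier_mat (Suc n) (Suc n)"
    by (simp_all add: A_def B_def C_def)
  have "A * B = C"
  proof (rule eq_matI)
    fix i j assume ij: "i < dim_row C" "j < dim_col C"
    then have ij': "i < Suc n" "j < Suc n" by (simp_all add: C_def)
    have "(A * B) $$ (i, j) = (\<Sum>k\<in>{0..<Suc n}. x i ^ (n - k) *
        (if k = j then 1 else if k = Suc j then - x 0 else 0))"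
      using ij' by (simp add: A_def B_def scalar_prod_def del: sum.op_ivl_Suc)
    also have "\<dots> = (\<Sum>k\<in>{0..<Suc n}. (if k = j then x i ^ (n - j) else 0) +
        (if k = Suc j then - x 0 * x i ^ (n - Suc j) else 0))"
      by (intro sum.cong) auto
    also have "\<dots> = x i ^ (n - j) + (if j < n then - x 0 * x i ^ (n - Suc j) else 0)"
      using ij' by (simp add: sum.distrib del: sum.op_ivl_Suc)
    also have "\<dots> = C $$ (i, j)"
    proof (cases "j < n")
      case True
      then have "x i ^ (n - j) = x i * x i ^ (n - 1 - j)"
        by (simp flip: power_Suc add: Suc_diff_Suc)
      with True ij' show ?thesis by (simp add: C_def algebra_simps)
    next
      case False
      with ij' show ?thesis by (simp add: C_def)
    qed
    finally show "(A * B) $$ (i, j) = C $$ (i, j)" .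
  qed (simp_all add: A_def B_def C_def)
  moreover have "Determinant.det B = 1"
    by (subst det_lower_triangular[OF _ B]) (auto simp: B_def prod_list_diag_prod)
  ultimately have "Determinant.det A = Determinant.det C"
    using det_mult[OF A B] by simp
  also have "\<dots> = (\<Sum>j<Suc n. C $$ (0, j) * cofactor C 0 j)"
    using C by (rule laplace_expansion_row) simp
  also have "\<dots> = (\<Sum>j\<in>{n}. C $$ (0, j) * cofactor C 0 j)"
    by (rule sum.mono_neutral_right) (auto simp: C_def)
  also have "\<dots> = (-1) ^ n * Determinant.det (mat_delete C 0 n)"
    by (simp add: C_def cofactor_def)
  also have "mat_delete C 0 n =
      Matrix.mat n n (\<lambda>(i, j). (x (Suc i) - x 0) * x (Suc i) ^ (n - 1 - j))"
    by (rule eq_matI) (auto simp: mat_delete_def C_def)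
  also have "Determinant.det \<dots> = (\<Prod>i<n. x (Suc i) - x 0) * (\<Prod>j<n. \<Prod>i<j. x (Suc i) - x (Suc j))"
    using Suc.IH[of "\<lambda>i. x (Suc i)"] by (simp add: det_scale_rows)
  \<comment> \<open>The cofactor sign is spent on reversing the \<open>n\<close> differences that
    involve \<open>x 0\<close>.\<close>
  also have "(-1) ^ n * ((\<Prod>i<n. x (Suc i) - x 0) * (\<Prod>j<n. \<Prod>i<j. x (Suc i) - x (Suc j))) =
      (\<Prod>i<n. x 0 - x (Suc i)) * (\<Prod>j<n. \<Prod>i<j. x (Suc i) - x (Suc j))"
  proof -
    have "(\<Prod>i<n. x 0 - x (Suc i)) = (\<Prod>i<n. (-1) * (x (Suc i) - x 0))" by simp
    also have "\<dots> = (-1) ^ n * (\<Prod>i<n. x (Suc i) - x 0)" by (subst prod.distrib) simp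
    finally show ?thesis by (simp add: mult.assoc)
  qed
  also have "\<dots> = (\<Prod>j<Suc n. \<Prod>i<j. x i - x j)"
    by (simp add: prod.lessThan_Suc_shift prod.distrib del: prod.lessThan_Suc)
  finally show ?case by (simp add: A_def)
qed

section \<open>Newton polytopes of products\<close>

definition real_vec :: "int ^ 'n \<Rightarrow> real ^ 'n" where
  "real_vec \<alpha> = (\<chi> i. real_of_int (\<alpha> $ i))"

lemma Newt_eq: "Newt f = convex hull (real_vec ` Poly_Mapping.keys f)"
  by (simp add: Newt_def real_vec_def [abs_def])

lemma real_vec_add: "real_vec (a + b) = real_vec a + real_vec b"
  by (simp add: real_vec_def Finite_Cartesian_Product.vec_eq_iff)

lemma real_vec_eq_iff [simp]: "real_vec a = real_vec b \<longleftrightarrow> a = b"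
  by (simp add: real_vec_def Finite_Cartesian_Product.vec_eq_iff)

lemma real_vec_0 [simp]: "real_vec 0 = 0"
  by (simp add: real_vec_def Finite_Cartesian_Product.vec_eq_iff)

lemma real_vec_axis: "real_vec (axis i c) = of_int c *\<^sub>R axis i 1"
  by (simp add: real_vec_def Finite_Cartesian_Product.vec_eq_iff axis_def)

text \<open>The coefficient of a product is a convolution sum. If the exponent splits in only one
  way, a single term of that sum survives and nothing can cancel it.\<close>

lemma lookup_times_unique:
  fixes f g :: "'a::cancel_comm_monoid_add \<Rightarrow>\<^sub>0 'b::comm_semiring_1"
  assumes "a \<in> Poly_Mapping.keys f" "b \<in> Poly_Mapping.keys g"
    and uniq: "\<And>a' b'. \<lbrakk>a' \<in> Poly_Mapping.keys f; b' \<in> Poly_Mapping.keys g; a' + b' = a + b\<rbrakk>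
      \<Longrightarrow> a' = a \<and> b' = b"
  shows "Poly_Mapping.lookup (f * g) (a + b) = Poly_Mapping.lookup f a * Poly_Mapping.lookup g b"
proof -
  have decomp: "h = (\<Sum>a\<in>Poly_Mapping.keys h. Poly_Mapping.single a (Poly_Mapping.lookup h a))"
    for h :: "'a \<Rightarrow>\<^sub>0 'b"
    by (rule poly_mapping_eqI) (auto simp: lookup_sum lookup_single when_def in_keys_iff)
  have "f * g = (\<Sum>a'\<in>Poly_Mapping.keys f. \<Sum>b'\<in>Poly_Mapping.keys g.
      Poly_Mapping.single (a' + b') (Poly_Mapping.lookup f a' * Poly_Mapping.lookup g b'))"
    by (subst decomp[of f], subst decomp[of g]) (simp add: sum_product mult_single)
  then have "Poly_Mapping.lookup (f * g) (a + b) =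
      (\<Sum>a'\<in>Poly_Mapping.keys f. \<Sum>b'\<in>Poly_Mapping.keys g.
        (Poly_Mapping.lookup f a' * Poly_Mapping.lookup g b' when a' + b' = a + b))"
    by (simp add: lookup_sum lookup_single)
  also have "\<dots> = (\<Sum>a'\<in>Poly_Mapping.keys f. \<Sum>b'\<in>Poly_Mapping.keys g.
        if b' = b then if a' = a then Poly_Mapping.lookup f a * Poly_Mapping.lookup g b else 0 else 0)"
    by (intro sum.cong refl) (use uniq in \<open>auto simp: when_def\<close>)
  finally show ?thesis
    using assms(1,2) by simp
qed

text \<open>Exchanging summands exhibits \<open>a + b\<close> as the midpoint of
  \<open>a + b'\<close> and \<open>a' + b\<close>, both in \<open>A + B\<close>. Extremality makes
  these two points equal, and together with \<open>eq\<close> this gives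
  \<open>2 a = 2 a'\<close>.\<close>

lemma extreme_point_of_set_plus_unique:
  fixes A B :: "'a::real_vector set"
  assumes ext: "(a + b) extreme_point_of (A + B)"
    and "a \<in> A" "b \<in> B" "a' \<in> A" "b' \<in> B" and eq: "a' + b' = a + b"
  shows "a' = a \<and> b' = b"
proof -
  have "(a + b') + (a' + b) = (a' + b') + (a + b)"
    by (simp add: ac_simps)
  then have "a + b = midpoint (a + b') (a' + b)"
    by (simp only: midpoint_def eq scaleR_half_double inverse_eq_divide)
  moreover have "a + b' \<in> A + B" "a' + b \<in> A + B"
    using assms by auto
  ultimately have "midpoint (a + b') (a' + b) \<notin> open_segment (a + b') (a' + b)"
    using ext by (simp only: extreme_point_of_def) blast
  then have "a + b' = a' + b"
    by (simp only: midpoint_in_open_segment not_not)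
  with eq have "(a + a) + (b + b') = (a' + a') + (b + b')"
    by (metis add.assoc add.commute)
  then have "2 *\<^sub>R a = 2 *\<^sub>R a'"
    by (simp only: add_right_cancel scaleR_2)
  then have "a = a'" by simp
  with eq show ?thesis by simp
qed

text \<open>No cancellation can occur at a vertex of the Minkowski sum, since it decomposes uniquely.\<close>

lemma Newt_times: "Newt (f * g) = Newt f + Newt g"
proof
  let ?K = "\<lambda>f. real_vec ` Poly_Mapping.keys f"
  have "?K (f * g) \<subseteq> ?K f + ?K g"
  proof clarify
    fix v assume "v \<in> Poly_Mapping.keys (f * g)"
    with keys_mult obtain a b where "a \<in> Poly_Mapping.keys f" "b \<in> Poly_Mapping.keys g" "v = a + b"
      by blast
    then show "real_vec v \<in> ?K f + ?K g"
      by (auto simp: real_vec_add)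
  qed
  then show "Newt (f * g) \<subseteq> Newt f + Newt g"
    unfolding Newt_eq convex_hull_set_plus[symmetric] by (rule hull_mono)
  have "v \<in> ?K (f * g)" if v: "v extreme_point_of (convex hull (?K f + ?K g))" for v
  proof -
    obtain a b where a: "a \<in> Poly_Mapping.keys f" and b: "b \<in> Poly_Mapping.keys g"
      and vab: "v = real_vec a + real_vec b"
      using extreme_point_of_convex_hull[OF v] by (auto elim!: set_plus_elim)
    have "Poly_Mapping.lookup (f * g) (a + b) = Poly_Mapping.lookup f a * Poly_Mapping.lookup g b"
    proof (rule lookup_times_unique[OF a b])
      fix a' b' assume "a' \<in> Poly_Mapping.keys f" "b' \<in> Poly_Mapping.keys g" "a' + b' = a + b"
      then have "real_vec a' = real_vec a \<and> real_vec b' = real_vec b"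
        using v a b unfolding vab convex_hull_set_plus
        by (intro extreme_point_of_set_plus_unique)
          (auto intro: hull_inc simp only: real_vec_add[symmetric])
      then show "a' = a \<and> b' = b" by simp
    qed
    with a b have "a + b \<in> Poly_Mapping.keys (f * g)"
      by (simp add: in_keys_iff)
    then show ?thesis
      by (auto simp: vab simp flip: real_vec_add)
  qed
  \<comment> \<open>A polytope is the hull of its extreme points, so it suffices that these occur
    among the exponents of the product.\<close>
  then have "convex hull {v. v extreme_point_of (convex hull (?K f + ?K g))} \<subseteq> Newt (f * g)"
    unfolding Newt_eq by (intro hull_mono) auto
  then show "Newt f + Newt g \<subseteq> Newt (f * g)"
    unfolding Newt_eq convex_hull_set_plus[symmetric]
    by (subst Krein_Milman_polytope) (auto simp: finite_set_plus)
qed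

text \<open>The \<open>0\<close> on the right is the singleton of the origin, the neutral element of
  Minkowski addition.\<close>

lemma Newt_1 [simp]: "Newt 1 = 0"
  by (simp add: Newt_eq set_zero flip: single_one)

lemma Newt_prod: "Newt (prod f A) = (\<Sum>a\<in>A. Newt (f a))"
  by (induction A rule: infinite_finite_induct) (simp_all add: Newt_times)

section \<open>Segments and their Minkowski sums\<close>

lemma Newt_single_diff_single:
  assumes "a \<noteq> b" "c \<noteq> 0" "d \<noteq> 0"
  shows "Newt (Poly_Mapping.single a c - Poly_Mapping.single b d) =
    closed_segment (real_vec a) (real_vec b)"
proof -
  have "Poly_Mapping.keys (Poly_Mapping.single a c - Poly_Mapping.single b d) = {a, b}"
    using assms by (auto simp: in_keys_iff lookup_minus lookup_single when_def split: if_splits)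
  then show ?thesis
    by (simp add: Newt_eq segment_convex_hull)
qed

lemma Newt_const: "c \<noteq> 0 \<Longrightarrow> Newt (laurent_const c) = 0"
  by (simp add: Newt_eq laurent_const_def set_zero)

text \<open>Points with parameters \<open>u\<close> and \<open>v\<close> on the two segments add up
  to \<open>(v - u)\<close> times \<open>x - y\<close>, and \<open>v - u\<close> ranges over the
  interval from -1 to 1. This turns pairs of factors into the centred generators of the
  zonotope.\<close>

lemma sum_closed_segment_opposite:
  fixes x y :: "'a::real_vector"
  shows "closed_segment x y + closed_segment (- x) (- y) = closed_segment (- (x - y)) (x - y)"
proof (intro equalityI subsetI)
  fix z assume "z \<in> closed_segment x y + closed_segment (- x) (- y)"
  then obtain u v where uv: "0 \<le> u" "u \<le> 1" "0 \<le> v" "v \<le> 1"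
    and z: "z = ((1 - u) *\<^sub>R x + u *\<^sub>R y) + ((1 - v) *\<^sub>R (- x) + v *\<^sub>R (- y))"
    by (auto simp: closed_segment_def elim!: set_plus_elim)
  \<comment> \<open>The affine rescaling of \<open>v - u\<close> from the interval between -1 and 1
    to the unit interval.\<close>
  define s where "s = (1 + v - u) / 2"
  have "z = (v - u) *\<^sub>R (x - y)"
    by (simp add: z algebra_simps)
  also have "v - u = s - (1 - s)"
    by (simp add: s_def field_simps)
  also have "(s - (1 - s)) *\<^sub>R (x - y) = (1 - s) *\<^sub>R (- (x - y)) + s *\<^sub>R (x - y)"
    by (simp only: scaleR_left_diff_distrib[of s "1 - s"] scaleR_minus_right) simp
  finally show "z \<in> closed_segment (- (x - y)) (x - y)"
    unfolding closed_segment_def using uv by (auto simp: s_def)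
next
  fix z assume "z \<in> closed_segment (- (x - y)) (x - y)"
  then obtain s where s: "0 \<le> s" "s \<le> 1" "z = (1 - s) *\<^sub>R (- (x - y)) + s *\<^sub>R (x - y)"
    by (auto simp: closed_segment_def)
  \<comment> \<open>The parameters \<open>u = 1 - s\<close> and \<open>v = s\<close> have the
    required difference \<open>2 s - 1\<close>.\<close>
  have "z = ((1 - (1 - s)) *\<^sub>R x + (1 - s) *\<^sub>R y) + ((1 - s) *\<^sub>R (- x) + s *\<^sub>R (- y))"
    by (simp add: s algebra_simps)
  moreover have "(1 - (1 - s)) *\<^sub>R x + (1 - s) *\<^sub>R y \<in> closed_segment x y"
    "(1 - s) *\<^sub>R (- x) + s *\<^sub>R (- y) \<in> closed_segment (- x) (- y)"
    using s unfolding closed_segment_def by (auto intro: exI[of _ "1 - s"])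
  ultimately show "z \<in> closed_segment x y + closed_segment (- x) (- y)"
    by auto
qed

lemma closed_segment_symmetric_eq:
  fixes v :: "'a::real_vector"
  assumes "a \<ge> 0"
  shows "closed_segment (- (a *\<^sub>R v)) (a *\<^sub>R v) = (\<lambda>s. s *\<^sub>R v) ` {-a..a}"
proof -
  have "closed_segment (- (a *\<^sub>R v)) (a *\<^sub>R v) = (\<lambda>s. s *\<^sub>R v) ` closed_segment (-a) a"
    using closed_segment_linear_image[of "\<lambda>s. s *\<^sub>R v" "- a" a] by (simp add: linear_iff algebra_simps)
  with assms show ?thesis by (simp add: closed_segment_eq_real_ivl)
qed

lemma sum_closed_segment_scaled:
  fixes v :: "'a::real_vector"
  assumes "a \<ge> 0" "b \<ge> 0"
  shows "closed_segment (- (a *\<^sub>R v)) (a *\<^sub>R v) + closed_segment (- (b *\<^sub>R v)) (b *\<^sub>R v) =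
    closed_segment (- ((a + b) *\<^sub>R v)) ((a + b) *\<^sub>R v)"
proof -
  have ivl: "{-a..a} + {-b..b} = {-(a+b)..a+b}"
  proof (intro equalityI subsetI)
    fix z assume z: "z \<in> {-(a+b)..a+b}"
    \<comment> \<open>Clamping \<open>z\<close> to the first interval leaves a remainder that fits
      into the second.\<close>
    define x where "x = max (-a) (min a z)"
    have "x \<in> {-a..a}" "z - x \<in> {-b..b}"
      using z assms by (auto simp: x_def)
    then show "z \<in> {-a..a} + {-b..b}"
      using set_plus_intro[of x "{-a..a}" "z - x" "{-b..b}"] by simp
  next
    fix z assume "z \<in> {-a..a} + {-b..b}"
    then obtain x y where "z = x + y" "x \<in> {-a..a}" "y \<in> {-b..b}"
      by (rule set_plus_elim)
    then show "z \<in> {-(a+b)..a+b}"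
      by simp
  qed
  have image_plus: "f ` A + f ` B = f ` (A + B)" if "\<And>x y. f (x + y) = f x + f y"
    for f :: "real \<Rightarrow> 'a" and A B
    unfolding set_plus_image image_image by (force simp: that image_iff)
  show ?thesis
    unfolding closed_segment_symmetric_eq[OF assms(1)] closed_segment_symmetric_eq[OF assms(2)]
      closed_segment_symmetric_eq[OF add_nonneg_nonneg[OF assms]]
    by (subst image_plus) (simp_all only: ivl scaleR_add_left)
qed

text \<open>Meant for the \<open>t\<close> roots of unity, each of which contributes the same
  segment once the factors with a variable and with its inverse are paired.\<close>

lemma sum_segments_const:
  fixes v :: "'a::real_vector"
  shows "(\<Sum>a<n. closed_segment (- v) v) = closed_segment (- (real n *\<^sub>R v)) (real n *\<^sub>R v)"
proof (induction n)
  case (Suc n)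
  have "(\<Sum>a<Suc n. closed_segment (- v) v) =
      closed_segment (- (real n *\<^sub>R v)) (real n *\<^sub>R v) + closed_segment (- (1 *\<^sub>R v)) (1 *\<^sub>R v)"
    by (simp only: sum.lessThan_Suc Suc scaleR_one)
  also have "\<dots> = closed_segment (- ((real n + 1) *\<^sub>R v)) ((real n + 1) *\<^sub>R v)"
    by (rule sum_closed_segment_scaled) simp_all
  finally show ?case
    by (simp only: of_nat_Suc add.commute)
qed (simp add: set_zero)

section \<open>The Newton polytope of \<open>N_delta\<close> as a zonotope\<close>

lemma nth_concat_pairs:
  assumes "m < r"
  shows "concat (map (\<lambda>k. [f k, g k]) [1..<r + 1]) ! (2 * m) = f (Suc m)"
    and "concat (map (\<lambda>k. [f k, g k]) [1..<r + 1]) ! Suc (2 * m) = g (Suc m)"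
proof -
  have len: "length (concat (map (\<lambda>k. [f k, g k]) [1..<n + 1])) = 2 * n" for n
    by (induction n) auto
  have "concat (map (\<lambda>k. [f k, g k]) [1..<r + 1]) ! (2 * m) = f (Suc m) \<and>
        concat (map (\<lambda>k. [f k, g k]) [1..<r + 1]) ! Suc (2 * m) = g (Suc m)"
    using assms
  proof (induction r)
    case (Suc r)
    show ?case
    proof (cases "m = r")
      case True
      then show ?thesis using len[of r] by (simp add: nth_append del: length_concat One_nat_def) simp
    next
      case False
      then show ?thesis using Suc len[of r] by (simp add: nth_append del: length_concat One_nat_def)
    qed
  qed simp
  then show "concat (map (\<lambda>k. [f k, g k]) [1..<r + 1]) ! (2 * m) = f (Suc m)"
    and "concat (map (\<lambda>k. [f k, g k]) [1..<r + 1]) ! Suc (2 * m) = g (Suc m)"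
    by auto
qed

text \<open>List positions count from 0 while the variables are numbered from 1, hence
  \<open>Suc m\<close>.\<close>

lemma spec_vars_nth:
  shows "a < t \<Longrightarrow> spec_vars t r ix ! a = laurent_const (zeta t ^ a)"
    and "m < r \<Longrightarrow> spec_vars t r ix ! (t + 2 * m) = laurent_var (ix (Suc m))"
    and "m < r \<Longrightarrow> spec_vars t r ix ! (t + Suc (2 * m)) = laurent_var_inv (ix (Suc m))"
  unfolding spec_vars_def
  by (simp_all only: nth_append_left nth_append_length_plus length_map length_upt diff_zero nth_map
      nth_upt nth_concat_pairs add_0 nth_append_length_plus[of "map f [0..<t]" for f, simplified])

text \<open>Two such exponentials agree iff their exponents are congruent modulo \<open>t\<close>.
  It keeps the constant factors of the Vandermonde product nonzero.\<close>

lemma inj_on_zeta_power: "inj_on (\<lambda>a. zeta t ^ a) {..<t}"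
proof (cases "t = 0")
  case False
  have eq: "zeta t ^ a = exp (2 * of_real pi * \<i> * of_nat a / of_nat t)" for a
    by (simp add: zeta_def exp_of_nat_mult[symmetric] mult.commute)
  show ?thesis
    using False by (auto simp: inj_on_def eq complex_root_unity_eq cong_def)
qed simp

lemma sum_lessThan_add_pairs:
  fixes F :: "nat \<Rightarrow> 'a::comm_monoid_add"
  shows "(\<Sum>i<t + 2 * m. F i) = (\<Sum>i<t. F i) + (\<Sum>q<m. F (t + 2 * q) + F (t + Suc (2 * q)))"
  by (induction m) (simp_all add: ac_simps)

text \<open>Grouping by the larger index matches the Vandermonde product, whose outer index is the
  larger one.\<close>

lemma sum_pairs_less:
  fixes F :: "nat \<Rightarrow> nat \<Rightarrow> 'a::comm_monoid_add"
  shows "(\<Sum>(k, l)\<in>{(k, l). 1 \<le> k \<and> k < l \<and> l \<le> r}. F k l) = (\<Sum>l\<in>{1..r}. \<Sum>k\<in>{1..<l}. F k l)"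
  unfolding sum.Sigma[OF finite_atLeastAtMost ballI[OF finite_atLeastLessThan]]
  by (rule sum.reindex_bij_witness[of _ prod.swap prod.swap]) auto

text \<open>These are all the kinds of factors of the Vandermonde product other than differences of
  two roots of unity.\<close>

lemma Newt_diff_spec_vars:
  fixes ix :: "nat \<Rightarrow> 'r::finite"
  shows "c \<noteq> 0 \<Longrightarrow> Newt (laurent_const c - laurent_var (ix k)) = closed_segment 0 (std_basis ix k)"
    and "c \<noteq> 0 \<Longrightarrow> Newt (laurent_const c - laurent_var_inv (ix k)) = closed_segment 0 (- std_basis ix k)"
    and "Newt (laurent_var (ix k) - laurent_var_inv (ix k)) =
      closed_segment (- std_basis ix k) (std_basis ix k)"
    and "ix k \<noteq> ix l \<Longrightarrow> Newt (laurent_var (ix k) - laurent_var (ix l)) =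
      closed_segment (std_basis ix k) (std_basis ix l)"
    and "ix k \<noteq> ix l \<Longrightarrow> Newt (laurent_var (ix k) - laurent_var_inv (ix l)) =
      closed_segment (std_basis ix k) (- std_basis ix l)"
    and "ix k \<noteq> ix l \<Longrightarrow> Newt (laurent_var_inv (ix k) - laurent_var (ix l)) =
      closed_segment (- std_basis ix k) (std_basis ix l)"
    and "ix k \<noteq> ix l \<Longrightarrow> Newt (laurent_var_inv (ix k) - laurent_var_inv (ix l)) =
      closed_segment (- std_basis ix k) (- std_basis ix l)"
proof -
  have neq: "axis i (a::int) \<noteq> axis j b" if "i \<noteq> j \<or> a \<noteq> b" "a \<noteq> 0" for i j :: 'r and a b
    using that by (auto simp: axis_eq_axis)
  have neq0: "0 \<noteq> axis i (a::int)" if "a \<noteq> 0" for i :: 'r and a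
    using that by (simp add: axis_eq_0_iff eq_commute[of 0])
  note simps = laurent_const_def laurent_var_def laurent_var_inv_def std_basis_def real_vec_axis
    Newt_single_diff_single neq neq0
  show "c \<noteq> 0 \<Longrightarrow> Newt (laurent_const c - laurent_var (ix k)) = closed_segment 0 (std_basis ix k)"
    by (simp add: simps)
  show "c \<noteq> 0 \<Longrightarrow> Newt (laurent_const c - laurent_var_inv (ix k)) = closed_segment 0 (- std_basis ix k)"
    by (simp add: simps)
  show "Newt (laurent_var (ix k) - laurent_var_inv (ix k)) =
      closed_segment (- std_basis ix k) (std_basis ix k)"
    by (simp add: simps closed_segment_commute)
  show "ix k \<noteq> ix l \<Longrightarrow> Newt (laurent_var (ix k) - laurent_var (ix l)) =
      closed_segment (std_basis ix k) (std_basis ix l)"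
    by (simp add: simps)
  show "ix k \<noteq> ix l \<Longrightarrow> Newt (laurent_var (ix k) - laurent_var_inv (ix l)) =
      closed_segment (std_basis ix k) (- std_basis ix l)"
    by (simp add: simps)
  show "ix k \<noteq> ix l \<Longrightarrow> Newt (laurent_var_inv (ix k) - laurent_var (ix l)) =
      closed_segment (- std_basis ix k) (std_basis ix l)"
    by (simp add: simps)
  show "ix k \<noteq> ix l \<Longrightarrow> Newt (laurent_var_inv (ix k) - laurent_var_inv (ix l)) =
      closed_segment (- std_basis ix k) (- std_basis ix l)"
    by (simp add: simps)
qed

text \<open>The sum of the Newton polytopes of the Vandermonde factors is built up by adjoining one
  pair of a variable and its inverse at a time; \<open>step\<close> computes what each pair
  adds.\<close>

lemma Newt_N_delta:
  fixes ix :: "nat \<Rightarrow> 'r::finite"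
  assumes inj: "inj_on ix {1..r}"
  shows "Newt (N_delta t r ix) = zonotope_C t r ix"
proof -
  define x where "x = (\<lambda>i. spec_vars t r ix ! i)"
  let ?e = "std_basis ix" and ?S = "\<lambda>v::real^'r. closed_segment (- v) v"
  note x_simps = x_def spec_vars_nth
  have zeta_nz: "zeta t ^ a \<noteq> 0" for a
    by (simp add: zeta_def)
  \<comment> \<open>A difference of two distinct roots of unity is a nonzero constant, so its Newton
    polytope is the origin.\<close>
  have const: "Newt (x i - x j) = 0" if "i < j" "j < t" for i j
  proof -
    have "x i - x j = laurent_const (zeta t ^ i - zeta t ^ j)"
      using that by (simp add: x_simps laurent_const_def single_diff)
    moreover have "zeta t ^ i \<noteq> zeta t ^ j"
      using inj_onD[OF inj_on_zeta_power, of t i j] that by auto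
    ultimately show ?thesis
      by (simp add: Newt_const)
  qed
  have ix_neq: "ix (Suc q) \<noteq> ix (Suc m)" if "q < m" "m < r" for q m
    using inj_onD[OF inj, of "Suc q" "Suc m"] that by auto
  have step: "(\<Sum>i<t + 2 * m. Newt (x i - x (t + 2 * m)) + Newt (x i - x (t + Suc (2 * m)))) +
      Newt (x (t + 2 * m) - x (t + Suc (2 * m))) =
      ?S (real (t + 1) *\<^sub>R ?e (Suc m)) +
      (\<Sum>k\<in>{1..<Suc m}. ?S (?e k - ?e (Suc m)) + ?S (?e k + ?e (Suc m)))" if "m < r" for m
  proof -
    let ?F = "\<lambda>i. Newt (x i - x (t + 2 * m)) + Newt (x i - x (t + Suc (2 * m)))"
    have "?F i = ?S (?e (Suc m))" if "i < t" for i
    proof -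
      \<comment> \<open>Writing the second left end as \<open>- 0\<close> puts the two segments in
        opposite position.\<close>
      have "?F i = closed_segment 0 (?e (Suc m)) + closed_segment (- 0) (- ?e (Suc m))"
        using that \<open>m < r\<close> by (simp only: x_simps Newt_diff_spec_vars(1,2)[OF zeta_nz] minus_zero)
      also have "\<dots> = ?S (?e (Suc m))"
        by (simp only: sum_closed_segment_opposite)
          (simp only: diff_0 minus_minus closed_segment_commute)
      finally show ?thesis .
    qed
    then have root_sum: "(\<Sum>i<t. ?F i) = ?S (real t *\<^sub>R ?e (Suc m))"
      by (simp add: sum_segments_const)
    have self: "Newt (x (t + 2 * m) - x (t + Suc (2 * m))) = ?S (?e (Suc m))"
      using \<open>m < r\<close> by (simp only: x_simps Newt_diff_spec_vars)
    \<comment> \<open>The roots of unity give the coefficient \<open>t\<close>; the difference of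
      the variable and its own inverse raises it to \<open>t + 1\<close>.\<close>
    have seg: "?S (real t *\<^sub>R ?e (Suc m)) + ?S (?e (Suc m)) = ?S (real (t + 1) *\<^sub>R ?e (Suc m))"
      using sum_closed_segment_scaled[of "real t" 1 "?e (Suc m)"]
      by (simp only: of_nat_add of_nat_1 scaleR_one of_nat_0_le_iff zero_le_one simp_thms)
    have pairs: "?F (t + 2 * q) + ?F (t + Suc (2 * q)) =
        ?S (?e (Suc q) - ?e (Suc m)) + ?S (?e (Suc q) + ?e (Suc m))" if "q < m" for q
    proof -
      have "q < r" using that \<open>m < r\<close> by simp
      then have "?F (t + 2 * q) + ?F (t + Suc (2 * q)) =
        (closed_segment (?e (Suc q)) (?e (Suc m)) + closed_segment (?e (Suc q)) (- ?e (Suc m))) +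
        (closed_segment (- ?e (Suc q)) (?e (Suc m)) + closed_segment (- ?e (Suc q)) (- ?e (Suc m)))"
        using \<open>m < r\<close>
        by (simp only: x_simps Newt_diff_spec_vars(4-)[where ix = ix, OF ix_neq[OF that \<open>m < r\<close>]] add.assoc)
      \<comment> \<open>The four differences between two pairs of variables regroup into two couples
        of opposite segments, one for each of the directions \<open>e_k - e_l\<close> and
        \<open>e_k + e_l\<close>.\<close>
      also have "\<dots> =
        (closed_segment (?e (Suc q)) (?e (Suc m)) + closed_segment (- ?e (Suc q)) (- ?e (Suc m))) +
        (closed_segment (?e (Suc q)) (- ?e (Suc m)) + closed_segment (- ?e (Suc q)) (- (- ?e (Suc m))))"
        by (simp add: ac_simps)
      also have "\<dots> = ?S (?e (Suc q) - ?e (Suc m)) + ?S (?e (Suc q) - (- ?e (Suc m)))"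
        by (simp only: sum_closed_segment_opposite)
      finally show ?thesis by simp
    qed
    have shift: "(\<Sum>k\<in>{1..<Suc m}. ?S (?e k - ?e (Suc m)) + ?S (?e k + ?e (Suc m))) =
        (\<Sum>q<m. ?S (?e (Suc q) - ?e (Suc m)) + ?S (?e (Suc q) + ?e (Suc m)))"
      by (simp only: One_nat_def sum.shift_bounds_Suc_ivl lessThan_atLeast0)
    have "(\<Sum>i<t + 2 * m. ?F i) + Newt (x (t + 2 * m) - x (t + Suc (2 * m))) =
        (\<Sum>i<t. ?F i) + (\<Sum>q<m. ?F (t + 2 * q) + ?F (t + Suc (2 * q))) + ?S (?e (Suc m))"
      by (simp only: sum_lessThan_add_pairs self)
    also have "(\<Sum>q<m. ?F (t + 2 * q) + ?F (t + Suc (2 * q))) =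
        (\<Sum>q<m. ?S (?e (Suc q) - ?e (Suc m)) + ?S (?e (Suc q) + ?e (Suc m)))"
      by (intro sum.cong refl pairs) simp
    finally show ?thesis
      unfolding root_sum shift seg[symmetric] by (simp only: ac_simps)
  qed
  have "(\<Sum>j<t + 2 * m. \<Sum>i<j. Newt (x i - x j)) =
      (\<Sum>l\<in>{1..m}. ?S (real (t + 1) *\<^sub>R ?e l) + (\<Sum>k\<in>{1..<l}. ?S (?e k - ?e l) + ?S (?e k + ?e l)))"
    if "m \<le> r" for m
    using that
  proof (induction m)
    case 0
    then show ?case by (simp add: const del: set_zero)
  next
    case (Suc m)
    have "(\<Sum>j<t + 2 * Suc m. \<Sum>i<j. Newt (x i - x j)) =
      (\<Sum>j<t + 2 * m. \<Sum>i<j. Newt (x i - x j)) +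
      ((\<Sum>i<t + 2 * m. Newt (x i - x (t + 2 * m)) + Newt (x i - x (t + Suc (2 * m)))) +
      Newt (x (t + 2 * m) - x (t + Suc (2 * m))))"
      by (simp add: sum.distrib ac_simps)
    with Suc step[of m] show ?case by simp
  qed
  from this[of r] show ?thesis
    unfolding N_delta_def Let_def det_vandermonde zonotope_C_def sum_pairs_less
    by (simp add: Newt_prod sum.distrib x_def)
qed

section \<open>Unique maxima of linear functionals\<close>

text \<open>These are the exposed points, with the exposing functional \<open>c\<close> kept
  explicit because Minkowski sums are handled one functional at a time.\<close>

definition unique_max :: "'a::real_inner \<Rightarrow> 'a set \<Rightarrow> 'a \<Rightarrow> bool" where
  "unique_max c A p \<longleftrightarrow> p \<in> A \<and> (\<forall>q\<in>A. q \<noteq> p \<longrightarrow> c \<bullet> q < c \<bullet> p)"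

text \<open>A functional is maximised on a Minkowski sum by maximising it on each summand
  independently; holding one summand fixed shows that uniqueness passes to the other.\<close>

lemma unique_max_plus:
  "unique_max c (A + B) m \<longleftrightarrow> (\<exists>p q. unique_max c A p \<and> unique_max c B q \<and> m = p + q)"
proof
  assume m: "unique_max c (A + B) m"
  then obtain p q where pq: "p \<in> A" "q \<in> B" "m = p + q"
    by (auto simp: unique_max_def elim: set_plus_elim)
  have "c \<bullet> p' < c \<bullet> p" if "p' \<in> A" "p' \<noteq> p" for p'
  proof -
    have "p' + q \<in> A + B" "p' + q \<noteq> m"
      using that pq by auto
    then have "c \<bullet> (p' + q) < c \<bullet> m"
      using m by (simp add: unique_max_def)
    then show ?thesis by (simp add: pq inner_add_right)
  qed
  moreover have "c \<bullet> q' < c \<bullet> q" if "q' \<in> B" "q' \<noteq> q" for q'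
  proof -
    have "p + q' \<in> A + B" "p + q' \<noteq> m"
      using that pq by auto
    then have "c \<bullet> (p + q') < c \<bullet> m"
      using m by (simp add: unique_max_def)
    then show ?thesis by (simp add: pq inner_add_right)
  qed
  ultimately show "\<exists>p q. unique_max c A p \<and> unique_max c B q \<and> m = p + q"
    using pq by (auto simp: unique_max_def)
next
  assume "\<exists>p q. unique_max c A p \<and> unique_max c B q \<and> m = p + q"
  then obtain p q where p: "unique_max c A p" and q: "unique_max c B q" and m: "m = p + q"
    by blast
  have "c \<bullet> z < c \<bullet> m" if z: "z \<in> A + B" "z \<noteq> m" for z
  proof -
    obtain p' q' where z': "z = p' + q'" "p' \<in> A" "q' \<in> B"
      using z by (auto elim: set_plus_elim)
    have p': "p' = p \<or> c \<bullet> p' < c \<bullet> p" and q': "q' = q \<or> c \<bullet> q' < c \<bullet> q"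
      using z'(2,3) p q by (simp_all only: unique_max_def) blast+
    have "p' \<noteq> p \<or> q' \<noteq> q"
      using z'(1) z(2) m by metis
    then have "c \<bullet> p' + c \<bullet> q' < c \<bullet> p + c \<bullet> q"
      using p' q' by (elim disjE) simp_all
    then show ?thesis
      by (simp only: z'(1) m inner_add_right)
  qed
  moreover have "m \<in> A + B"
    using p q m by (auto simp: unique_max_def)
  ultimately show "unique_max c (A + B) m"
    by (simp add: unique_max_def)
qed

text \<open>The shape separates the condition on \<open>c\<close> for a unique maximum to exist from
  the point where it is attained, so that both accumulate over a sum.\<close>

lemma unique_max_plus_iff:
  assumes "\<And>p. unique_max c A p \<longleftrightarrow> P \<and> p = a" and "\<And>q. unique_max c B q \<longleftrightarrow> Q \<and> q = b"
  shows "unique_max c (A + B) m \<longleftrightarrow> (P \<and> Q) \<and> m = a + b"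
  unfolding unique_max_plus assms by (cases "P \<and> Q") auto

lemma unique_max_singleton: "unique_max c {a} p \<longleftrightarrow> p = a"
  unfolding unique_max_def by blast

lemma unique_max_sum:
  assumes "finite J" and "\<And>j p. j \<in> J \<Longrightarrow> unique_max c (A j) p \<longleftrightarrow> P j \<and> p = v j"
  shows "unique_max c (\<Sum>j\<in>J. A j) p \<longleftrightarrow> (\<forall>j\<in>J. P j) \<and> p = (\<Sum>j\<in>J. v j)"
  using assms
proof (induction J arbitrary: p rule: finite_induct)
  case empty
  then show ?case by (simp add: unique_max_singleton)
next
  case (insert j J)
  have "unique_max c (\<Sum>j\<in>J. A j) p \<longleftrightarrow> (\<forall>j\<in>J. P j) \<and> p = (\<Sum>j\<in>J. v j)" for p
    by (rule insert.IH) (simp add: insert.prems)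
  with insert.hyps insert.prems[of j] show ?case
    by (simp add: unique_max_plus)
qed

text \<open>At the point \<open>s\<close> times \<open>g\<close> the functional has the value
  \<open>s * (c \<bullet> g)\<close>, which for \<open>s\<close> between -1 and 1 peaks only at the
  sign of \<open>c \<bullet> g\<close>, or is constant when that product is 0. For
  \<open>g = 0\<close> the segment is a point and every \<open>c\<close> has a unique maximum, hence
  the assumption.\<close>

lemma unique_max_segment:
  assumes "g \<noteq> 0"
  shows "unique_max c (closed_segment (- g) g) p \<longleftrightarrow> c \<bullet> g \<noteq> 0 \<and> p = sgn (c \<bullet> g) *\<^sub>R g"
proof -
  have mem: "z \<in> closed_segment (- g) g \<longleftrightarrow> (\<exists>s. \<bar>s\<bar> \<le> 1 \<and> z = s *\<^sub>R g)" for z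
  proof
    assume "z \<in> closed_segment (- g) g"
    then obtain u where "0 \<le> u" "u \<le> 1" "z = (1 - u) *\<^sub>R (- g) + u *\<^sub>R g"
      by (auto simp: closed_segment_def)
    then have "z = (u - (1 - u)) *\<^sub>R g" "\<bar>u - (1 - u)\<bar> \<le> 1"
      unfolding scaleR_left_diff_distrib[of u "1 - u"] by simp_all
    then show "\<exists>s. \<bar>s\<bar> \<le> 1 \<and> z = s *\<^sub>R g" by blast
  next
    assume "\<exists>s. \<bar>s\<bar> \<le> 1 \<and> z = s *\<^sub>R g"
    then obtain s where s: "\<bar>s\<bar> \<le> 1" "z = s *\<^sub>R g" by blast
    define u where "u = (1 + s) / 2"
    have "s = u - (1 - u)" by (simp add: u_def field_simps)
    then have "z = (1 - u) *\<^sub>R (- g) + u *\<^sub>R g"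
      by (simp only: s scaleR_left_diff_distrib[of u "1 - u"] scaleR_minus_right) simp
    moreover have "0 \<le> u" "u \<le> 1" using s by (auto simp: u_def)
    ultimately show "z \<in> closed_segment (- g) g"
      by (auto simp: closed_segment_def)
  qed
  show ?thesis
  proof
    assume p: "unique_max c (closed_segment (- g) g) p"
    have all: "c \<bullet> (s *\<^sub>R g) < c \<bullet> p" if "\<bar>s\<bar> \<le> 1" "s *\<^sub>R g \<noteq> p" for s
    proof -
      have "s *\<^sub>R g \<in> closed_segment (- g) g"
        unfolding mem using that(1) by (intro exI[of _ s]) simp
      then show ?thesis
        using p that(2) unfolding unique_max_def by blast
    qed
    have "p \<in> closed_segment (- g) g"
      using p unfolding unique_max_def by blast
    then obtain s where s: "\<bar>s\<bar> \<le> 1" "p = s *\<^sub>R g"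
      unfolding mem by (elim exE conjE)
    have lt: "s' * (c \<bullet> g) < s * (c \<bullet> g)" if "\<bar>s'\<bar> \<le> 1" "s' \<noteq> s" for s'
      using all[of s'] that s assms by simp
    \<comment> \<open>A functional constant on the segment would force both 0 and 1 to equal
      \<open>s\<close>.\<close>
    have nz: "c \<bullet> g \<noteq> 0"
    proof
      assume "c \<bullet> g = 0"
      then have "s' = s" if "\<bar>s'\<bar> \<le> 1" for s'
        using lt that by force
      from this[of 0] this[of 1] show False by simp
    qed
    moreover have "s = sgn (c \<bullet> g)"
    proof (rule ccontr)
      assume "s \<noteq> sgn (c \<bullet> g)"
      moreover have "\<bar>sgn (c \<bullet> g)\<bar> \<le> 1"
        by (simp add: sgn_if)
      ultimately have "sgn (c \<bullet> g) * (c \<bullet> g) < s * (c \<bullet> g)"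
        using lt[of "sgn (c \<bullet> g)"] by auto
      then have "\<bar>c \<bullet> g\<bar> < s * (c \<bullet> g)"
        by (simp add: abs_sgn mult.commute)
      also have "\<dots> \<le> \<bar>s\<bar> * \<bar>c \<bullet> g\<bar>"
        by (simp flip: abs_mult)
      also have "\<dots> \<le> \<bar>c \<bullet> g\<bar>"
        using s by (simp add: mult_left_le_one_le)
      finally show False by simp
    qed
    ultimately show "c \<bullet> g \<noteq> 0 \<and> p = sgn (c \<bullet> g) *\<^sub>R g"
      using s by simp
  next
    assume asm: "c \<bullet> g \<noteq> 0 \<and> p = sgn (c \<bullet> g) *\<^sub>R g"
    have "s * (c \<bullet> g) < \<bar>c \<bullet> g\<bar>" if "\<bar>s\<bar> \<le> 1" "s \<noteq> sgn (c \<bullet> g)" for s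
    proof (cases "c \<bullet> g > 0")
      case True
      with that have "s < 1" by simp
      with True show ?thesis by simp
    next
      case False
      with asm have neg: "c \<bullet> g < 0" by auto
      with that have "- 1 < s" by auto
      with neg show ?thesis using mult_strict_right_mono_neg[of "- 1" s "c \<bullet> g"] by simp
    qed
    moreover have "sgn (c \<bullet> g) * (c \<bullet> g) = \<bar>c \<bullet> g\<bar>"
      by (simp add: abs_sgn mult.commute)
    moreover have "p \<in> closed_segment (- g) g"
      unfolding mem using asm by (intro exI[of _ "sgn (c \<bullet> g)"]) (simp add: sgn_if)
    ultimately show "unique_max c (closed_segment (- g) g) p"
      using asm by (auto simp: unique_max_def mem)
  qed
qed

text \<open>Faces of polyhedra are exposed, so a supporting hyperplane meets the polytope in the
  extreme point alone, and its normal is the functional \<open>c\<close>.\<close>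

lemma extreme_point_iff_unique_max:
  fixes S :: "'a::euclidean_space set"
  assumes "polytope S"
  shows "p extreme_point_of S \<longleftrightarrow> (\<exists>c. unique_max c S p)"
proof
  assume "p extreme_point_of S"
  then have "{p} exposed_face_of S"
    using exposed_face_of_polyhedron[OF polytope_imp_polyhedron[OF assms]]
    by (simp add: face_of_singleton)
  then obtain c b where "S \<subseteq> {x. c \<bullet> x \<le> b}" "{p} = S \<inter> {x. c \<bullet> x = b}"
    unfolding exposed_face_of_def by blast
  then have "p \<in> S" "c \<bullet> p = b" "\<And>q. q \<in> S \<Longrightarrow> c \<bullet> q \<le> b" "\<And>q. \<lbrakk>q \<in> S; c \<bullet> q = b\<rbrakk> \<Longrightarrow> q = p"
    by blast+
  then have "unique_max c S p"
    unfolding unique_max_def by (metis order_less_le)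
  then show "\<exists>c. unique_max c S p" ..
next
  assume "\<exists>c. unique_max c S p"
  then obtain c where c: "unique_max c S p" ..
  show "p extreme_point_of S"
  proof (rule extreme_point_of_Int_supporting_hyperplane_le)
    show "S \<inter> {x. c \<bullet> x = c \<bullet> p} = {p}"
      using c by (force simp: unique_max_def)
    show "c \<bullet> x \<le> c \<bullet> p" if "x \<in> S" for x
      using c that by (force simp: unique_max_def)
  qed
qed

section \<open>The vertices of the zonotope\<close>

text \<open>The complement of the reflection hyperplanes of type C, where \<open>x_i = 0\<close> or
  \<open>x_i\<close> is plus or minus \<open>x_j\<close>.\<close>

definition generic :: "real ^ 'n \<Rightarrow> bool" where
  "generic c \<longleftrightarrow> (\<forall>i. c $ i \<noteq> 0) \<and> inj (\<lambda>i. \<bar>c $ i\<bar>)"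

definition num_smaller :: "real ^ 'n \<Rightarrow> 'n \<Rightarrow> nat" where
  "num_smaller c i = card {j. \<bar>c $ j\<bar> < \<bar>c $ i\<bar>}"

text \<open>For generic \<open>c\<close> the absolute values of the entries are
  \<open>t + 1\<close>, \<open>t + 3\<close> and so on up to \<open>t + 2 r - 1\<close> for
  \<open>r\<close> coordinates, in the order of the absolute values of \<open>c\<close>.\<close>

definition vertex :: "nat \<Rightarrow> real ^ 'n \<Rightarrow> real ^ 'n" where
  "vertex t c = (\<chi> i. sgn (c $ i) * (real t + 1 + 2 * real (num_smaller c i)))"

lemma num_smaller_inj:
  assumes "generic c" "num_smaller c i = num_smaller c j"
  shows "i = j"
proof (rule ccontr)
  assume "i \<noteq> j"
  have lt: "num_smaller c i < num_smaller c j" if "\<bar>c $ i\<bar> < \<bar>c $ j\<bar>" for i j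
    unfolding num_smaller_def using that by (intro psubset_card_mono) auto
  have "\<bar>c $ i\<bar> \<noteq> \<bar>c $ j\<bar>"
    using assms(1) \<open>i \<noteq> j\<close> by (auto simp: generic_def inj_def)
  then consider "\<bar>c $ i\<bar> < \<bar>c $ j\<bar>" | "\<bar>c $ j\<bar> < \<bar>c $ i\<bar>"
    by linarith
  then show False
    using lt[of i j] lt[of j i] assms(2) by cases simp_all
qed

lemma num_smaller_less: "num_smaller c i < CARD('n)" for c :: "real ^ 'n"
  unfolding num_smaller_def by (intro psubset_card_mono) auto

text \<open>If \<open>c_j\<close> is smaller than \<open>c_i\<close> in absolute value, both signs
  equal that of \<open>c_i\<close>; if it is larger, they cancel.\<close>

lemma sum_sgn_eq:
  assumes "generic c"
  shows "(\<Sum>j\<in>UNIV - {i}. sgn (c $ i - c $ j) + sgn (c $ i + c $ j)) =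
    2 * real (num_smaller c i) * sgn (c $ i)"
proof -
  have "sgn (c $ i - c $ j) + sgn (c $ i + c $ j) =
      (if \<bar>c $ j\<bar> < \<bar>c $ i\<bar> then 2 * sgn (c $ i) else 0)" if "j \<noteq> i" for j
  proof -
    have "\<bar>c $ i\<bar> \<noteq> \<bar>c $ j\<bar>" "c $ i \<noteq> 0" "c $ j \<noteq> 0"
      using assms that by (auto simp: generic_def inj_def)
    then show ?thesis
      by (auto simp: sgn_if abs_if split: if_splits)
  qed
  then have "(\<Sum>j\<in>UNIV - {i}. sgn (c $ i - c $ j) + sgn (c $ i + c $ j)) =
      (\<Sum>j\<in>UNIV - {i}. if \<bar>c $ j\<bar> < \<bar>c $ i\<bar> then 2 * sgn (c $ i) else 0)"
    by (intro sum.cong) auto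
  also have "\<dots> = (\<Sum>j | \<bar>c $ j\<bar> < \<bar>c $ i\<bar>. 2 * sgn (c $ i))"
    by (rule sum.mono_neutral_cong_right) auto
  also have "\<dots> = 2 * real (num_smaller c i) * sgn (c $ i)"
    by (simp add: num_smaller_def)
  finally show ?thesis .
qed

text \<open>Genericity is nonvanishing on every generator: two numbers differ in absolute value iff
  their difference and their sum are both nonzero.\<close>

lemma generic_iff:
  fixes ix :: "nat \<Rightarrow> 'n::finite"
  assumes "bij_betw ix {1..r} UNIV"
  shows "generic c \<longleftrightarrow> (\<forall>k\<in>{1..r}. c $ ix k \<noteq> 0) \<and>
    (\<forall>k l. 1 \<le> k \<and> k < l \<and> l \<le> r \<longrightarrow> c $ ix k - c $ ix l \<noteq> 0 \<and> c $ ix k + c $ ix l \<noteq> 0)"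
    (is "_ \<longleftrightarrow> ?nz \<and> ?ne")
proof
  assume c: "generic c"
  have "c $ ix k - c $ ix l \<noteq> 0 \<and> c $ ix k + c $ ix l \<noteq> 0" if "1 \<le> k \<and> k < l \<and> l \<le> r" for k l
  proof -
    have "ix k \<noteq> ix l"
      by (rule inj_on_contraD[OF bij_betw_imp_inj_on[OF assms]]) (use that in auto)
    then have "\<bar>c $ ix k\<bar> \<noteq> \<bar>c $ ix l\<bar>"
      using c by (auto simp: generic_def inj_def)
    then show ?thesis by auto
  qed
  with c show "?nz \<and> ?ne" by (simp add: generic_def)
next
  assume asm: "?nz \<and> ?ne"
  have idx: "\<exists>k\<in>{1..r}. i = ix k" for i
    using bij_betw_imp_surj_on[OF assms] by blast
  have abs: "\<bar>c $ ix k\<bar> \<noteq> \<bar>c $ ix l\<bar>" if "1 \<le> k" "k < l" "l \<le> r" for k l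
    using asm that by (smt (verit))
  have "i = j" if "\<bar>c $ i\<bar> = \<bar>c $ j\<bar>" for i j
  proof -
    obtain k l where "k \<in> {1..r}" "i = ix k" "l \<in> {1..r}" "j = ix l"
      using idx by meson
    with that abs[of k l] abs[of l k] show ?thesis
      by (cases k l rule: linorder_cases) auto
  qed
  moreover have "c $ i \<noteq> 0" for i
    using idx[of i] asm by auto
  ultimately show "generic c"
    by (auto simp: generic_def inj_def)
qed

text \<open>Index \<open>m\<close> occurs as the smaller member with each \<open>l\<close> above it
  and as the larger member with each \<open>k\<close> below it, so its partners are all the other
  indices.\<close>

lemma sum_pairs_less_symmetric:
  fixes F :: "nat \<Rightarrow> nat \<Rightarrow> 'a::comm_monoid_add"
  assumes "m \<in> {1..r}"
  shows "(\<Sum>(k, l)\<in>{(k, l). 1 \<le> k \<and> k < l \<and> l \<le> r}.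
      (if k = m then F k l else 0) + (if l = m then F l k else 0)) = (\<Sum>l\<in>{1..r} - {m}. F m l)"
proof -
  have "(\<Sum>l\<in>{1..r}. \<Sum>k\<in>{1..<l}. if k = m then F k l else 0) =
      (\<Sum>l\<in>{1..r}. if m < l then F m l else 0)"
    using assms by (intro sum.cong refl) simp
  also have "\<dots> = (\<Sum>l\<in>{m<..r}. F m l)"
    by (rule sum.mono_neutral_cong_right) (use assms in auto)
  finally have "(\<Sum>l\<in>{1..r}. \<Sum>k\<in>{1..<l}. if k = m then F k l else 0) = (\<Sum>l\<in>{m<..r}. F m l)" .
  moreover have "(\<Sum>l\<in>{1..r}. \<Sum>k\<in>{1..<l}. if l = m then F l k else 0) = (\<Sum>k\<in>{1..<m}. F m k)"
  proof -
    have "(\<Sum>l\<in>{1..r}. \<Sum>k\<in>{1..<l}. if l = m then F l k else 0) =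
        (\<Sum>l\<in>{1..r}. if l = m then \<Sum>k\<in>{1..<m}. F m k else 0)"
      by (intro sum.cong refl) simp
    also have "\<dots> = (\<Sum>k\<in>{1..<m}. F m k)"
      using assms by (simp only: sum.delta' sum.delta finite_atLeastAtMost if_True)
    finally show ?thesis .
  qed
  moreover have "{1..r} - {m} = {1..<m} \<union> {m<..r}" "{1..<m} \<inter> {m<..r} = {}"
    using assms by auto
  ultimately show ?thesis
    by (simp add: sum_pairs_less sum.distrib sum.union_disjoint add.commute del: One_nat_def)
qed

lemma vertex_eq_sum:
  fixes ix :: "nat \<Rightarrow> 'n::finite" and c :: "real ^ 'n"
  assumes ix: "bij_betw ix {1..r} UNIV" and c: "generic c"
  shows "(\<Sum>k\<in>{1..r}. sgn (c $ ix k) *\<^sub>R (real (t + 1) *\<^sub>R std_basis ix k)) +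
      (\<Sum>(k, l)\<in>{(k, l). 1 \<le> k \<and> k < l \<and> l \<le> r}.
        sgn (c $ ix k - c $ ix l) *\<^sub>R (std_basis ix k - std_basis ix l) +
        sgn (c $ ix k + c $ ix l) *\<^sub>R (std_basis ix k + std_basis ix l)) = vertex t c"
    (is "?A + ?B = _")
proof -
  let ?P = "{(k, l). 1 \<le> k \<and> k < l \<and> l \<le> r}"
  let ?h = "\<lambda>k l. sgn (c $ ix k - c $ ix l) + sgn (c $ ix k + c $ ix l)"
  have "(?A + ?B) $ i = vertex t c $ i" for i
  proof -
    obtain m where m: "m \<in> {1..r}" and i: "i = ix m"
      using bij_betw_imp_surj_on[OF ix] by blast
    have e: "std_basis ix k $ i = (if k = m then 1 else 0)" if "k \<in> {1..r}" for k
      using inj_onD[OF bij_betw_imp_inj_on[OF ix], of k m] that m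
      by (auto simp: std_basis_def axis_def i)
    have "?A $ i = (\<Sum>k\<in>{1..r}. if k = m then real (t + 1) * sgn (c $ i) else 0)"
      unfolding sum_component
      by (intro sum.cong refl) (simp only: vector_scaleR_component e real_scaleR_def, simp add: i)
    also have "\<dots> = real (t + 1) * sgn (c $ i)"
      using m by simp
    finally have A: "?A $ i = real (t + 1) * sgn (c $ i)" .
    have "?B $ i = (\<Sum>(k, l)\<in>?P. (if k = m then ?h k l else 0) + (if l = m then ?h l k else 0))"
      unfolding sum_component
    proof (intro sum.cong refl, clarify)
      fix k l assume kl: "1 \<le> k" "k < l" "l \<le> r"
      \<comment> \<open>The entry -1 of \<open>e_k - e_l\<close> at \<open>l\<close> is absorbed by
        the oddness of the sign, which makes the term symmetric in the two indices.\<close>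
      have "sgn (c $ ix k - c $ ix l) = - sgn (c $ ix l - c $ ix k)"
        using sgn_minus[of "c $ ix l - c $ ix k"] by simp
      with kl show "(sgn (c $ ix k - c $ ix l) *\<^sub>R (std_basis ix k - std_basis ix l) +
          sgn (c $ ix k + c $ ix l) *\<^sub>R (std_basis ix k + std_basis ix l)) $ i =
          (if k = m then ?h k l else 0) + (if l = m then ?h l k else 0)"
        by (cases "k = m"; cases "l = m") (simp_all add: e add.commute)
    qed
    also have "\<dots> = (\<Sum>l\<in>{1..r} - {m}. ?h m l)"
      by (rule sum_pairs_less_symmetric[OF m])
    also have "\<dots> = (\<Sum>j\<in>UNIV - {i}. sgn (c $ i - c $ j) + sgn (c $ i + c $ j))"
      unfolding i by (rule sum.reindex_bij_betw) (rule bij_betw_DiffI[OF ix], use m in auto)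
    finally have B: "?B $ i = 2 * real (num_smaller c i) * sgn (c $ i)"
      using sum_sgn_eq[OF c] by simp
    show ?thesis
      unfolding vector_add_component A B by (simp add: vertex_def algebra_simps)
  qed
  then show ?thesis
    unfolding Finite_Cartesian_Product.vec_eq_iff by blast
qed

text \<open>Unique maxima add up along the Minkowski sum, so the maximiser is the sum of all
  generators, each with the sign that \<open>c\<close> takes on it.\<close>

lemma unique_max_zonotope_C_iff:
  fixes ix :: "nat \<Rightarrow> 'n::finite"
  assumes ix: "bij_betw ix {1..r} UNIV"
  shows "unique_max c (zonotope_C t r ix) p \<longleftrightarrow> generic c \<and> p = vertex t c"
proof -
  let ?e = "std_basis ix" and ?P = "{(k, l). 1 \<le> k \<and> k < l \<and> l \<le> r}"
  have fin: "finite ?P"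
    by (rule finite_subset[of _ "{1..r} \<times> {1..r}"]) auto
  have inner_e: "c \<bullet> ?e k = c $ ix k" for k
    by (simp add: std_basis_def inner_axis)
  have nz: "?e k \<noteq> 0" for k
    by (simp add: std_basis_def axis_eq_0_iff)
  have single: "unique_max c (closed_segment (- (real (t + 1) *\<^sub>R ?e k)) (real (t + 1) *\<^sub>R ?e k)) p \<longleftrightarrow>
      c $ ix k \<noteq> 0 \<and> p = sgn (c $ ix k) *\<^sub>R (real (t + 1) *\<^sub>R ?e k)" for k p
  proof -
    have "sgn (c \<bullet> (real (t + 1) *\<^sub>R ?e k)) = sgn (c $ ix k)"
      by (simp only: inner_scaleR_right inner_e sgn_mult) simp
    moreover have "c \<bullet> (real (t + 1) *\<^sub>R ?e k) \<noteq> 0 \<longleftrightarrow> c $ ix k \<noteq> 0"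
      by (simp only: inner_scaleR_right inner_e) simp
    moreover have "real (t + 1) *\<^sub>R ?e k \<noteq> 0"
      using nz[of k] by simp
    ultimately show ?thesis
      using unique_max_segment[of "real (t + 1) *\<^sub>R ?e k" c p] by (simp only: simp_thms)
  qed
  have pair: "unique_max c (closed_segment (- (?e k - ?e l)) (?e k - ?e l) +
        closed_segment (- (?e k + ?e l)) (?e k + ?e l)) p \<longleftrightarrow>
      (c $ ix k - c $ ix l \<noteq> 0 \<and> c $ ix k + c $ ix l \<noteq> 0) \<and>
      p = sgn (c $ ix k - c $ ix l) *\<^sub>R (?e k - ?e l) + sgn (c $ ix k + c $ ix l) *\<^sub>R (?e k + ?e l)"
    if "1 \<le> k" "k < l" "l \<le> r" for k l p
  proof -
    have "ix k \<noteq> ix l"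
      by (rule inj_on_contraD[OF bij_betw_imp_inj_on[OF ix]]) (use that in auto)
    \<comment> \<open>Both generators have the entry 1 at \<open>ix k\<close>, which shows that they
      are nonzero.\<close>
    then have "(?e k - ?e l) $ ix k \<noteq> 0" "(?e k + ?e l) $ ix k \<noteq> 0"
      by (simp_all add: std_basis_def axis_def)
    then have "?e k - ?e l \<noteq> 0" "?e k + ?e l \<noteq> 0"
      by (metis zero_index)+
    note seg = this[THEN unique_max_segment[of _ c], unfolded inner_diff_right inner_add_right inner_e]
    show ?thesis
      by (rule unique_max_plus_iff) (rule seg)+
  qed
  have "unique_max c (zonotope_C t r ix) p \<longleftrightarrow>
    ((\<forall>k\<in>{1..r}. c $ ix k \<noteq> 0) \<and>
    (\<forall>(k, l)\<in>?P. c $ ix k - c $ ix l \<noteq> 0 \<and> c $ ix k + c $ ix l \<noteq> 0)) \<and>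
    p = (\<Sum>k\<in>{1..r}. sgn (c $ ix k) *\<^sub>R (real (t + 1) *\<^sub>R ?e k)) +
      (\<Sum>(k, l)\<in>?P. sgn (c $ ix k - c $ ix l) *\<^sub>R (?e k - ?e l) +
        sgn (c $ ix k + c $ ix l) *\<^sub>R (?e k + ?e l))"
  proof -
    have A: "unique_max c (\<Sum>k\<in>{1..r}. closed_segment (- (real (t + 1) *\<^sub>R ?e k)) (real (t + 1) *\<^sub>R ?e k)) p \<longleftrightarrow>
        (\<forall>k\<in>{1..r}. c $ ix k \<noteq> 0) \<and>
        p = (\<Sum>k\<in>{1..r}. sgn (c $ ix k) *\<^sub>R (real (t + 1) *\<^sub>R ?e k))" for p
      by (rule unique_max_sum) (rule finite_atLeastAtMost, rule single)
    have B: "unique_max c (\<Sum>(k, l)\<in>?P. closed_segment (- (?e k - ?e l)) (?e k - ?e l) +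
        closed_segment (- (?e k + ?e l)) (?e k + ?e l)) p \<longleftrightarrow>
        (\<forall>(k, l)\<in>?P. c $ ix k - c $ ix l \<noteq> 0 \<and> c $ ix k + c $ ix l \<noteq> 0) \<and>
        p = (\<Sum>(k, l)\<in>?P. sgn (c $ ix k - c $ ix l) *\<^sub>R (?e k - ?e l) +
          sgn (c $ ix k + c $ ix l) *\<^sub>R (?e k + ?e l))" for p
    proof (rule unique_max_sum[OF fin], goal_cases)
      case (1 j p)
      then obtain k l where j: "j = (k, l)" "1 \<le> k" "k < l" "l \<le> r"
        by blast
      show ?case
        unfolding j(1) case_prod_conv by (rule pair[OF j(2-4)])
    qed
    show ?thesis
      unfolding zonotope_C_def Let_def by (rule unique_max_plus_iff[OF A B])
  qed
  also have "(\<forall>k\<in>{1..r}. c $ ix k \<noteq> 0) \<and>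
      (\<forall>(k, l)\<in>?P. c $ ix k - c $ ix l \<noteq> 0 \<and> c $ ix k + c $ ix l \<noteq> 0) \<longleftrightarrow> generic c"
    unfolding generic_iff[OF ix] by auto
  finally show ?thesis
    using vertex_eq_sum[OF ix, of c t] by (cases "generic c") (simp_all only: simp_thms)
qed

section \<open>The action of signed permutations on the vertices\<close>

lemma signed_permsD:
  assumes "w \<in> signed_perms"
  shows "\<exists>\<pi> s. \<pi> permutes UNIV \<and> (\<forall>i. s i = -1 \<or> s i = 1) \<and> (\<forall>x i. w x $ i = s i * x $ \<pi> i)"
proof -
  obtain \<pi> s where "\<pi> permutes UNIV" "\<forall>i. s i \<in> {-1, 1}" "w = (\<lambda>x. \<chi> i. s i * x $ \<pi> i)"
    using assms unfolding signed_perms_def by blast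
  then show ?thesis
    by (intro exI[of _ \<pi>] exI[of _ s]) auto
qed

lemma signed_permsI:
  assumes "\<pi> permutes UNIV" "\<And>i. s i = -1 \<or> s i = 1"
  shows "(\<lambda>x. \<chi> i. s i * x $ \<pi> i) \<in> signed_perms"
  unfolding signed_perms_def using assms by (intro CollectI exI[of _ \<pi>] exI[of _ s]) auto

lemma num_smaller_signed_perm:
  assumes "\<pi> permutes UNIV" and "\<And>i. \<bar>d $ i\<bar> = \<bar>c $ \<pi> i\<bar>"
  shows "num_smaller d i = num_smaller c (\<pi> i)"
proof -
  have "bij_betw \<pi> {j. \<bar>d $ j\<bar> < \<bar>d $ i\<bar>} {j. \<bar>c $ j\<bar> < \<bar>c $ \<pi> i\<bar>}"
    unfolding bij_betw_def
  proof
    show "inj_on \<pi> {j. \<bar>d $ j\<bar> < \<bar>d $ i\<bar>}"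
      using permutes_inj[OF assms(1)] by (rule inj_on_subset) simp
    show "\<pi> ` {j. \<bar>d $ j\<bar> < \<bar>d $ i\<bar>} = {j. \<bar>c $ j\<bar> < \<bar>c $ \<pi> i\<bar>}"
    proof (intro equalityI subsetI)
      fix j assume "j \<in> {j. \<bar>c $ j\<bar> < \<bar>c $ \<pi> i\<bar>}"
      moreover obtain k where "j = \<pi> k"
        using permutes_surj[OF assms(1)] by (metis surjD)
      ultimately show "j \<in> \<pi> ` {j. \<bar>d $ j\<bar> < \<bar>d $ i\<bar>}"
        by (auto simp: assms(2))
    qed (auto simp: assms(2))
  qed
  then show ?thesis
    unfolding num_smaller_def by (rule bij_betw_same_card)
qed

text \<open>A signed permutation carries along the signs of the entries and the ranks of their
  absolute values, and \<open>vertex\<close> depends on nothing else.\<close>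

lemma generic_signed_perm:
  assumes "w \<in> signed_perms" "generic c"
  shows "generic (w c)" and "vertex t (w c) = w (vertex t c)"
proof -
  obtain \<pi> s where \<pi>: "\<pi> permutes UNIV" and s: "\<And>i. s i = -1 \<or> s i = 1"
    and w: "\<And>x i. w x $ i = s i * x $ \<pi> i"
    using signed_permsD[OF assms(1)] by blast
  have abs: "\<bar>w c $ i\<bar> = \<bar>c $ \<pi> i\<bar>" for i
    using s[of i] by (auto simp: w)
  show "generic (w c)"
    unfolding generic_def
  proof
    show "\<forall>i. w c $ i \<noteq> 0"
      using assms(2) abs unfolding generic_def by (metis abs_eq_0)
    have "inj ((\<lambda>i. \<bar>c $ i\<bar>) \<circ> \<pi>)"
      using assms(2) permutes_inj[OF \<pi>] unfolding generic_def by (intro inj_compose) auto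
    then show "inj (\<lambda>i. \<bar>w c $ i\<bar>)"
      by (simp add: abs o_def)
  qed
  have "vertex t (w c) $ i = w (vertex t c) $ i" for i
    using s[of i] num_smaller_signed_perm[OF \<pi> abs, of i] by (auto simp: vertex_def w)
  then show "vertex t (w c) = w (vertex t c)"
    unfolding Finite_Cartesian_Product.vec_eq_iff by blast
qed

lemma top_vector_component:
  assumes "inj_on ix {1..r}" "m \<in> {1..r}"
  shows "top_vector N r ix $ ix m = real N - 2 * real m + 1"
proof -
  have "top_vector N r ix $ ix m = (\<Sum>k\<in>{1..r}. if k = m then real N - 2 * real m + 1 else 0)"
    unfolding top_vector_def sum_component
  proof (intro sum.cong refl)
    fix k assume "k \<in> {1..r}"
    then have "ix k = ix m \<longleftrightarrow> k = m"
      using assms inj_on_eq_iff by metis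
    then show "((real N - 2 * real k + 1) *\<^sub>R std_basis ix k) $ ix m =
        (if k = m then real N - 2 * real m + 1 else 0)"
      by (auto simp: std_basis_def axis_def)
  qed
  with assms(2) show ?thesis by simp
qed

text \<open>The entries are distinct, and the smallest, \<open>N - 2 r + 1\<close>, is at least
  1.\<close>

lemma generic_top_vector:
  assumes ix: "bij_betw ix {1..r} (UNIV :: 'n::finite set)" and N: "N \<ge> 2 * r"
  shows "generic (top_vector N r ix)" and "top_vector N r ix $ i > 0"
proof -
  note inj = bij_betw_imp_inj_on[OF ix]
  have pos: "top_vector N r ix $ i > 0" for i
  proof -
    obtain m where "m \<in> {1..r}" "i = ix m"
      using bij_betw_imp_surj_on[OF ix] by blast
    with N show ?thesis by (simp add: top_vector_component[OF inj])
  qed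
  then show "top_vector N r ix $ i > 0" .
  have "i = j" if "\<bar>top_vector N r ix $ i\<bar> = \<bar>top_vector N r ix $ j\<bar>" for i j
  proof -
    obtain k m where "k \<in> {1..r}" "i = ix k" "m \<in> {1..r}" "j = ix m"
      using bij_betw_imp_surj_on[OF ix] by (metis UNIV_I imageE)
    with that pos[of i] pos[of j] show ?thesis
      by (simp add: top_vector_component[OF inj])
  qed
  then show "generic (top_vector N r ix)"
    using pos by (auto simp: generic_def inj_def less_imp_neq[THEN not_sym])
qed

text \<open>Genericity makes the chamber inequalities strict, so exactly the \<open>r - k\<close>
  coordinates numbered above \<open>k\<close> are smaller than the \<open>k\<close>-th, and
  \<open>t + 1 + 2 (r - k) = N - 2 k + 1\<close>.\<close>

lemma vertex_dominant:
  assumes ix: "bij_betw ix {1..r} (UNIV :: 'n::finite set)" and N: "N = t + 2 * r"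
    and c: "generic c" "c \<in> dominant_chamber r ix"
  shows "vertex t c = top_vector N r ix"
proof -
  note inj = bij_betw_imp_inj_on[OF ix]
  have mono: "c $ ix l \<le> c $ ix k" if "1 \<le> k" "k \<le> l" "l \<le> r" for k l
    using c(2) that by (cases "k = l") (auto simp: dominant_chamber_def)
  have pos: "c $ ix k > 0" if "k \<in> {1..r}" for k
  proof -
    have "0 \<le> c $ ix r"
      using c(2) by (simp add: dominant_chamber_def)
    also have "\<dots> \<le> c $ ix k"
      using that by (intro mono) auto
    finally show ?thesis
      using c(1) by (auto simp: generic_def order_less_le)
  qed
  have less_iff: "c $ ix l < c $ ix k \<longleftrightarrow> k < l" if kl: "k \<in> {1..r}" "l \<in> {1..r}" for k l
  proof (cases "k < l")
    case True
    then have "ix k \<noteq> ix l"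
      using inj_on_eq_iff[OF inj kl] by simp
    then have "\<bar>c $ ix k\<bar> \<noteq> \<bar>c $ ix l\<bar>"
      using c(1) by (auto simp: generic_def inj_def)
    with mono[of k l] True kl show ?thesis by (auto simp: order_less_le)
  next
    case False
    with mono[of l k] kl show ?thesis by auto
  qed
  have "vertex t c $ ix k = top_vector N r ix $ ix k" if k: "k \<in> {1..r}" for k
  proof -
    have "{j. \<bar>c $ j\<bar> < \<bar>c $ ix k\<bar>} = ix ` {k<..r}"
    proof (intro equalityI subsetI)
      fix j assume j: "j \<in> {j. \<bar>c $ j\<bar> < \<bar>c $ ix k\<bar>}"
      obtain l where l: "l \<in> {1..r}" "j = ix l"
        using bij_betw_imp_surj_on[OF ix] by blast
      with j pos[OF k] pos[OF l(1)] have "k < l"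
        by (simp add: less_iff[OF k l(1), symmetric])
      with l show "j \<in> ix ` {k<..r}" by auto
    next
      fix j assume "j \<in> ix ` {k<..r}"
      then obtain l where l: "k < l" "l \<le> r" "j = ix l" by auto
      with k have "l \<in> {1..r}" by auto
      with l pos[OF k] pos[of l] less_iff[OF k, of l] show "j \<in> {j. \<bar>c $ j\<bar> < \<bar>c $ ix k\<bar>}"
        by simp
    qed
    then have "num_smaller c (ix k) = card (ix ` {k<..r})"
      by (simp add: num_smaller_def)
    also have "\<dots> = r - k"
      using k by (subst card_image) (auto intro: inj_on_subset[OF inj])
    finally have "num_smaller c (ix k) = r - k" .
    then show ?thesis
      using k pos[OF k] N by (simp add: vertex_def top_vector_component[OF inj] of_nat_diff)
  qed
  then have "vertex t c $ i = top_vector N r ix $ i" for i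
    using bij_betw_imp_surj_on[OF ix] by (metis UNIV_I imageE)
  then show ?thesis
    unfolding Finite_Cartesian_Product.vec_eq_iff by blast
qed

lemma top_vector_dominant:
  assumes ix: "bij_betw ix {1..r} (UNIV :: 'n::finite set)" and N: "N \<ge> 2 * r" and r: "r \<ge> 1"
  shows "top_vector N r ix \<in> dominant_chamber r ix"
  using N r by (auto simp: dominant_chamber_def top_vector_component[OF bij_betw_imp_inj_on[OF ix]])

lemma vertex_mem_orbit:
  assumes ix: "bij_betw ix {1..r} (UNIV :: 'n::finite set)" and N: "N = t + 2 * r"
    and c: "generic c"
  shows "\<exists>w\<in>signed_perms. vertex t c = w (top_vector N r ix)"
proof -
  \<comment> \<open>A coordinate of rank \<open>n\<close>, counted from 0, takes entry number
    \<open>r - n\<close> of the top vector, whose value is \<open>t + 1 + 2 n\<close>; the signs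
    come from \<open>c\<close>.\<close>
  define \<pi> where "\<pi> = (\<lambda>i. ix (r - num_smaller c i))"
  have r: "CARD('n) = r"
    using bij_betw_same_card[OF ix] by simp
  have mem: "r - num_smaller c i \<in> {1..r}" for i
    using num_smaller_less[of c i] by (simp add: r)
  have "inj \<pi>"
  proof (rule injI)
    fix i j assume "\<pi> i = \<pi> j"
    then have "r - num_smaller c i = r - num_smaller c j"
      unfolding \<pi>_def using inj_on_eq_iff[OF bij_betw_imp_inj_on[OF ix] mem mem] by simp
    then have "num_smaller c i = num_smaller c j"
      using num_smaller_less[of c i] num_smaller_less[of c j] by (simp add: r)
    with c show "i = j" by (rule num_smaller_inj)
  qed
  then have "\<pi> permutes UNIV"
    by (intro bij_imp_permutes) (simp_all add: bij_def finite_UNIV_inj_surj)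
  moreover have "sgn (c $ i) = -1 \<or> sgn (c $ i) = 1" for i
    using c by (simp add: generic_def sgn_if)
  ultimately have "(\<lambda>x. \<chi> i. sgn (c $ i) * x $ \<pi> i) \<in> signed_perms"
    by (rule signed_permsI)
  moreover have "vertex t c = (\<chi> i. sgn (c $ i) * top_vector N r ix $ \<pi> i)"
  proof -
    have "top_vector N r ix $ \<pi> i = real t + 1 + 2 * real (num_smaller c i)" for i
      unfolding \<pi>_def top_vector_component[OF bij_betw_imp_inj_on[OF ix] mem]
      using num_smaller_less[of c i] by (simp add: r N of_nat_diff)
    then show ?thesis
      by (simp add: vertex_def)
  qed
  ultimately show ?thesis by (intro bexI)
qed

section \<open>Counting signed permutations and their free orbits\<close>

text \<open>Absolute values recover the permutation because those of \<open>x\<close> are distinct;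
  cancelling the nonzero entries then recovers the signs.\<close>

lemma signed_perm_unique:
  fixes x :: "real ^ 'n::finite" and \<pi> \<pi>' :: "'n \<Rightarrow> 'n"
  assumes x: "generic x" "\<And>i. x $ i > 0" and \<pi>: "\<And>i. s i = -1 \<or> s i = 1" "\<And>i. s' i = -1 \<or> s' i = 1"
    and eq: "\<And>i. s i * x $ \<pi> i = s' i * x $ \<pi>' i"
  shows "\<pi> = \<pi>'" and "s = s'"
proof -
  have "\<bar>x $ \<pi> i\<bar> = \<bar>x $ \<pi>' i\<bar>" for i
    using eq[of i] \<pi>(1)[of i] \<pi>(2)[of i] by auto
  moreover have "inj (\<lambda>i. \<bar>x $ i\<bar>)"
    using x(1) by (simp add: generic_def)
  ultimately show "\<pi> = \<pi>'"
    by (intro ext) (rule injD)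
  then have "s i * x $ \<pi> i = s' i * x $ \<pi> i" for i
    using eq[of i] by simp
  moreover have "x $ \<pi> i \<noteq> 0" for i
    using x(2)[of "\<pi> i"] by simp
  ultimately show "s = s'"
    by (intro ext) (simp only: mult_cancel_right simp_thms)
qed

text \<open>Since \<open>signed_perms\<close> consists of functions, the pairs of a permutation and
  a sign choice must be shown to give different functions; evaluating at one generic positive vector
  separates them.\<close>

lemma card_signed_perms: "card (signed_perms :: (real ^ 'n \<Rightarrow> real ^ 'n::finite) set) = 2 ^ CARD('n) * fact CARD('n)"
proof -
  let ?f = "\<lambda>(\<pi>, s). (\<lambda>x::real^'n. (\<chi> i. s i * x $ \<pi> i) :: real^'n)"
  \<comment> \<open>Over \<open>UNIV\<close> extensionality is vacuous, so the second factor
    contains every choice of signs.\<close>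
  let ?D = "{\<pi>::'n \<Rightarrow> 'n. \<pi> permutes UNIV} \<times> ((UNIV :: 'n set) \<rightarrow>\<^sub>E {-1, 1::real})"
  obtain b :: "'n \<Rightarrow> nat" where b: "inj b"
    using finite_imp_inj_to_nat_seg[OF finite[of "UNIV :: 'n set"]] by blast
  define x where "x = (\<chi> i. real (b i) + 1)"
  have x: "generic x" "\<And>i. x $ i > 0"
  proof -
    show pos: "x $ i > 0" for i
      by (simp add: x_def)
    have "i = j" if "\<bar>x $ i\<bar> = \<bar>x $ j\<bar>" for i j
      using that by (intro injD[OF b]) (simp add: x_def)
    then show "generic x"
      using pos by (auto simp: generic_def inj_def less_imp_neq[THEN not_sym])
  qed
  have "inj_on ?f ?D"
  proof (rule inj_onI, clarify)
    fix \<pi> s \<pi>' s'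
    assume "s \<in> (UNIV :: 'n set) \<rightarrow>\<^sub>E {-1, 1::real}" "s' \<in> (UNIV :: 'n set) \<rightarrow>\<^sub>E {-1, 1::real}"
    then have sgn: "s i = -1 \<or> s i = 1" "s' i = -1 \<or> s' i = 1" for i
      by (auto simp: PiE_def Pi_def)
    assume "(\<lambda>x::real^'n. \<chi> i. s i * x $ \<pi> i) = (\<lambda>x. \<chi> i. s' i * x $ \<pi>' i)"
    then have "(\<chi> i. s i * x $ \<pi> i) $ j = (\<chi> i. s' i * x $ \<pi>' i) $ j" for j
      by (rule fun_cong[THEN arg_cong])
    then have "s j * x $ \<pi> j = s' j * x $ \<pi>' j" for j
      by (simp only: vec_lambda_beta)
    then show "\<pi> = \<pi>' \<and> s = s'"
      by (intro conjI signed_perm_unique[where s = s and s' = s', OF x sgn])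
  qed
  then have "card (?f ` ?D) = card ?D"
    by (rule card_image)
  moreover have "?f ` ?D = signed_perms"
  proof (intro equalityI subsetI)
    fix w :: "real ^ 'n \<Rightarrow> real ^ 'n" assume "w \<in> signed_perms"
    then obtain \<pi> s where \<pi>: "\<pi> permutes UNIV" "\<forall>i. s i = -1 \<or> s i = 1"
      and ws: "\<forall>x i. w x $ i = s i * x $ \<pi> i"
      by (elim signed_permsD[THEN exE] exE conjE)
    have w: "w = ?f (\<pi>, s)"
      by (intro ext) (simp add: Finite_Cartesian_Product.vec_eq_iff ws)
    have "(\<pi>, s) \<in> ?D" using \<pi> by (auto simp: PiE_def Pi_def)
    with w show "w \<in> ?f ` ?D" by (rule image_eqI)
  next
    fix w assume "w \<in> ?f ` ?D"
    then obtain \<pi> s where "(\<pi>, s) \<in> ?D" and w: "w = ?f (\<pi>, s)"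
      by (elim imageE SigmaE) simp
    then have "\<pi> permutes UNIV" "s \<in> UNIV \<rightarrow>\<^sub>E {-1, 1::real}"
      by simp_all
    then have "s i = -1 \<or> s i = 1" for i by (auto simp: PiE_def Pi_def)
    with \<open>\<pi> permutes UNIV\<close> show "w \<in> signed_perms"
      unfolding w case_prod_conv by (rule signed_permsI)
  qed
  ultimately have "card (signed_perms :: (real ^ 'n \<Rightarrow> real ^ 'n) set) = card ?D"
    by (simp only:)
  also have "\<dots> = 2 ^ CARD('n) * fact CARD('n)"
    by (simp add: card_cartesian_product card_permutations card_funcsetE numeral_2_eq_2)
  finally show ?thesis .
qed

lemma inj_on_signed_perms_generic:
  assumes x: "generic x" "\<And>i. x $ i > 0"
  shows "inj_on (\<lambda>w. w x) signed_perms"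
proof (rule inj_onI)
  fix w w' :: "real ^ 'a \<Rightarrow> real ^ 'a"
  assume w: "w \<in> signed_perms" "w' \<in> signed_perms" and eq: "w x = w' x"
  obtain \<pi> s where 1: "\<And>i. s i = -1 \<or> s i = 1" "\<And>x i. w x $ i = s i * x $ \<pi> i"
    using signed_permsD[OF w(1)] by blast
  obtain \<pi>' s' where 2: "\<And>i. s' i = -1 \<or> s' i = 1" "\<And>x i. w' x $ i = s' i * x $ \<pi>' i"
    using signed_permsD[OF w(2)] by blast
  have "s i * x $ \<pi> i = s' i * x $ \<pi>' i" for i
    unfolding 1(2)[symmetric] 2(2)[symmetric] eq ..
  from signed_perm_unique[where s = s and s' = s', OF x 1(1) 2(1) this] have "w y $ i = w' y $ i" for y i
    by (simp only: 1(2) 2(2))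
  then show "w = w'"
    by (intro ext) (simp only: Finite_Cartesian_Product.vec_eq_iff simp_thms)
qed

theorem proposition7p1:
  fixes t r N :: nat and ix :: "nat \<Rightarrow> 'r::finite"
  assumes "t \<ge> 2" and "r \<ge> 1" and "N = t + 2 * r"
    and "bij_betw ix {1..r} (UNIV :: 'r set)"
  shows "Newt (N_delta t r ix) = zonotope_C t r ix \<and>
         Newt (N_delta t r ix) = convex hull ((\<lambda>w. w (top_vector N r ix)) ` signed_perms) \<and>
         card {p. p extreme_point_of Newt (N_delta t r ix)} = 2 ^ r * fact r \<and>
         bij_betw (\<lambda>w. w (top_vector N r ix)) signed_perms
           {p. p extreme_point_of Newt (N_delta t r ix)} \<and>
         {p. p extreme_point_of Newt (N_delta t r ix)} \<inter> dominant_chamber r ix = {top_vector N r ix}"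
proof -
  note ix = assms(4) and N = assms(3)
  let ?P = "Newt (N_delta t r ix)" and ?top = "top_vector N r ix"
  let ?E = "{p. p extreme_point_of ?P}"
  have zonotope: "?P = zonotope_C t r ix"
    using Newt_N_delta bij_betw_imp_inj_on[OF ix] by blast
  have finite: "finite (real_vec ` Poly_Mapping.keys (N_delta t r ix))"
    by simp
  have "polytope ?P"
    unfolding Newt_eq polytope_def using finite by blast
  then have E: "?E = {vertex t c | c. generic c}"
    by (auto simp: extreme_point_iff_unique_max zonotope unique_max_zonotope_C_iff[OF ix])
  have N': "N \<ge> 2 * r" using N by simp
  note generic = generic_top_vector(1)[OF ix N'] and pos = generic_top_vector(2)[OF ix N']
  note dominant = top_vector_dominant[OF ix N' \<open>r \<ge> 1\<close>]
  \<comment> \<open>The top vector is generic and dominant, hence as a functional it is maximised at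
    itself.\<close>
  have fix_top: "vertex t ?top = ?top"
    by (rule vertex_dominant[OF ix N generic dominant])
  have orbit: "(\<lambda>w. w ?top) ` signed_perms = ?E"
  proof (intro equalityI subsetI)
    fix p assume "p \<in> (\<lambda>w. w ?top) ` signed_perms"
    then obtain w where w: "w \<in> signed_perms" "p = w ?top" by blast
    then have "p = vertex t (w ?top)"
      using generic_signed_perm(2)[OF w(1) generic, of t] by (simp add: fix_top)
    then show "p \<in> ?E"
      unfolding E using generic_signed_perm(1)[OF w(1) generic] by blast
  next
    fix p assume "p \<in> ?E"
    then show "p \<in> (\<lambda>w. w ?top) ` signed_perms"
      unfolding E using vertex_mem_orbit[OF ix N] by blast
  qed
  have bij: "bij_betw (\<lambda>w. w ?top) signed_perms ?E"
    unfolding bij_betw_def using inj_on_signed_perms_generic[OF generic pos] orbit by blast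
  have "card ?E = 2 ^ r * fact r"
    using bij_betw_same_card[OF bij] bij_betw_same_card[OF ix] by (simp add: card_signed_perms)
  moreover have "?P = convex hull ((\<lambda>w. w ?top) ` signed_perms)"
    unfolding orbit unfolding Newt_eq by (rule Krein_Milman_polytope[OF finite])
  moreover have "?E \<inter> dominant_chamber r ix = {?top}"
  proof (intro equalityI subsetI)
    fix p assume p: "p \<in> ?E \<inter> dominant_chamber r ix"
    then obtain w where w: "w \<in> signed_perms" "p = w ?top"
      using orbit by blast
    \<comment> \<open>Equivariance spreads the fixed point \<open>?top\<close> over its whole orbit,
      while dominance of \<open>p\<close> sends it to \<open>?top\<close>; so \<open>p\<close> is
      \<open>?top\<close>.\<close>
    have "vertex t p = p"
      using generic_signed_perm(2)[OF w(1) generic, of t] by (simp add: w(2) fix_top)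
    moreover have "vertex t p = ?top"
      using vertex_dominant[OF ix N] generic_signed_perm(1)[OF w(1) generic] p w(2) by blast
    ultimately show "p \<in> {?top}" by simp
  next
    fix p assume "p \<in> {?top}"
    moreover have "?top \<in> ?E"
      unfolding E using fix_top generic by force
    ultimately show "p \<in> ?E \<inter> dominant_chamber r ix"
      using dominant by simp
  qed
  ultimately show ?thesis
    using zonotope bij by blast
qed

end
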